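(* Let $E\subseteq\mathbb{R}^d$ be an ellipsoid and let $\Lambda\subseteq\mathbb{R}^d$ be a lattice. Then \[\lvert E\cap\Lambda\rvert\leqslant\prod_{i=1}^{d}\left\lfloor\frac{1}{\lambda_i(\mathfrak{D}E,\Lambda)}+1\right\rfloor.\]
   Context: A lattice $\Lambda\subseteq\mathbb{R}^d$ is a discrete subgroup of rank $d$ (the $\mathbb{Z}$-span of a basis of $\mathbb{R}^d$). An ellipsoid is the image of a closed Euclidean unit ball under an invertible affine map of $\mathbb{R}^d$ (it need not be centered at the origin). For $T\subseteq\mathbb{R}^d$, $\mathfrak{D}T:=T-T=\{x-y : x,y\in T\}$ is the difference set, and $\lvert T\rvert$ denotes cardinality. For a convex body $K$ symmetric about the origin, the $i$-th successive minimum is $\lambda_i(K,\Lambda)=\inf\{\lambda>0 : (\lambda K)\cap\Lambda \text{ contains } i \text{ linearly independent points}\}$. $\lfloor\cdot\rfloor$ denotes the integer part. *)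

theory Defs
  imports "HOL-Analysis.Analysis"
begin

definition is_lattice :: "(real ^ 'd) set \<Rightarrow> bool" where
  "is_lattice \<Lambda> \<longleftrightarrow>
     (\<exists>B. independent B \<and> span B = UNIV \<and>
          \<Lambda> = range (\<lambda>c :: real ^ 'd \<Rightarrow> int. \<Sum>b\<in>B. of_int (c b) *\<^sub>R b))"

definition is_ellipsoid :: "(real ^ 'd) set \<Rightarrow> bool" where
  "is_ellipsoid E \<longleftrightarrow>
     (\<exists>L t. linear L \<and> bij L \<and> E = (\<lambda>x :: real ^ 'd. L x + t) ` cball 0 1)"

definition difference_set :: "'a::ab_group_add set \<Rightarrow> 'a set" where
  "difference_set T = {x - y |x y. x \<in> T \<and> y \<in> T}"

(* The infimum is taken in the reals. For 1 \<le> i \<le> d, a full-rank lattice and a convex body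
   with the origin in its interior, the set is nonempty and bounded below by 0; outside that
   range the value carries no meaning. *)
definition successive_min :: "nat \<Rightarrow> (real ^ 'd) set \<Rightarrow> (real ^ 'd) set \<Rightarrow> real" where
  "successive_min i K \<Lambda> =
     Inf {l. l > 0 \<and> (\<exists>S. S \<subseteq> ((\<lambda>x. l *\<^sub>R x) ` K) \<inter> \<Lambda> \<and> independent S \<and> card S = i)}"

end

theory Submission
  imports Defs
begin

text \<open>
  After a linear change of coordinates the ellipsoid is a unit ball. Let \<open>q\<^sub>i\<close> be the \<open>i\<close>-th factor of
  the product; then \<open>q\<^sub>1 \<ge> \<dots> \<ge> q\<^sub>d\<close>, and the lattice vectors \<open>v\<close> with \<open>q\<^sub>i\<bar>v\<bar> \<le> 2\<close> span a space of
  dimension less than \<open>i\<close>. By induction on the rank \<open>n\<close> of a subgroup \<open>M\<close> one bounds by \<open>q\<^sub>1\<cdots>q\<^sub>n\<close>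
  the total number of points of \<open>M\<close> in any family of unit balls that are pairwise disjoint modulo
  \<open>q\<^sub>nM\<close>. Write \<open>M = M' + \<int>b\<close> with all \<open>v\<close> satisfying \<open>q\<^sub>n\<bar>v\<bar> \<le> 2\<close> in \<open>M'\<close>, and sort the layers \<open>M' + kb\<close>
  by the residue of \<open>k\<close> modulo \<open>q\<^sub>n\<close>. Within one residue class the layers, translated into \<open>M'\<close>, give
  balls disjoint modulo \<open>q\<^sub>nM'\<close>. Moving every centre into the Voronoi cell of \<open>q\<^sub>nM'\<close> makes
  them disjoint modulo \<open>pM'\<close> for every \<open>p \<ge> q\<^sub>n\<close>, in particular for \<open>p = q\<^bsub>n-1\<^esub>\<close>. This stretching step
  is the one that needs a Euclidean norm.
\<close>

section \<open>Discrete subgroups and splitting off a rank-one part\<close>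

definition discrete_subgroup :: "'a::euclidean_space set \<Rightarrow> bool" where
  "discrete_subgroup M \<longleftrightarrow>
     0 \<in> M \<and> (\<forall>x\<in>M. \<forall>y\<in>M. x - y \<in> M) \<and> (\<forall>R. finite {x \<in> M. norm x \<le> R})"

lemma discrete_subgroupD:
  assumes "discrete_subgroup M"
  shows "0 \<in> M" "\<And>x y. x \<in> M \<Longrightarrow> y \<in> M \<Longrightarrow> x - y \<in> M"
    "\<And>R. finite {x \<in> M. norm x \<le> R}"
  using assms unfolding discrete_subgroup_def by auto

lemma discrete_subgroup_add:
  assumes "discrete_subgroup M" "x \<in> M" "y \<in> M"
  shows "x + y \<in> M"
proof -
  have "x - (0 - y) \<in> M"
    using assms by (intro discrete_subgroupD)
  then show ?thesis by simp
qed

lemma discrete_subgroup_scaleR_int: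
  assumes "discrete_subgroup M" "x \<in> M"
  shows "of_int k *\<^sub>R x \<in> M"
proof (induction k rule: int_induct[where k = 0])
  case base
  then show ?case using assms by (simp add: discrete_subgroupD)
next
  case (step1 i)
  then show ?case
    using discrete_subgroup_add[OF assms(1) _ assms(2)] by (simp add: scaleR_add_left)
next
  case (step2 i)
  then show ?case
    using discrete_subgroupD(2)[OF assms(1) _ assms(2)] by (simp add: scaleR_diff_left)
qed

lemma discrete_subgroup_scaleR_nat:
  assumes "discrete_subgroup M" "x \<in> M"
  shows "real k *\<^sub>R x \<in> M"
  using discrete_subgroup_scaleR_int[OF assms, of "int k"] by simp

lemma discrete_subgroup_sum:
  assumes "discrete_subgroup M" "\<And>i. i \<in> I \<Longrightarrow> f i \<in> M"
  shows "sum f I \<in> M"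
  using assms(2)
  by (induction I rule: infinite_finite_induct)
    (auto simp: discrete_subgroupD[OF assms(1)] intro: discrete_subgroup_add[OF assms(1)])

lemma discrete_subgroup_Int_subspace:
  assumes "discrete_subgroup M" "subspace U"
  shows "discrete_subgroup (M \<inter> U)"
proof -
  have "finite {x \<in> M \<inter> U. norm x \<le> R}" for R
    by (rule finite_subset[OF _ discrete_subgroupD(3)[OF assms(1), of R]]) auto
  then show ?thesis
    using assms unfolding discrete_subgroup_def by (auto simp: subspace_0 subspace_diff)
qed

text \<open>A basis of \<open>X\<close> extends to a basis \<open>A\<close> of \<open>M\<close>, and
  the dimension gap leaves some \<open>a\<close> in \<open>A\<close> outside the first one.
  \<open>M'\<close> is the kernel in \<open>M\<close> of the \<open>a\<close>-coordinate
  \<open>f\<close>, and \<open>b\<close> is an element with the least positive value of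
  \<open>f\<close>; division with remainder by \<open>f b\<close> then yields the layers.\<close>

lemma discrete_subgroup_hyperplane:
  fixes M :: "'a::euclidean_space set"
  assumes M: "discrete_subgroup M" and "X \<subseteq> M" "dim X < dim M"
  obtains M' b where "discrete_subgroup M'" "X \<subseteq> M'" "M' \<subseteq> M" "b \<in> M" "dim M = Suc (dim M')"
    "\<And>v. v \<in> M \<Longrightarrow> \<exists>k::int. v - of_int k *\<^sub>R b \<in> M'"
    "\<And>k::int. k \<noteq> 0 \<Longrightarrow> of_int k *\<^sub>R b \<notin> M'"
proof -
  obtain A0 where A0: "A0 \<subseteq> X" "independent A0" "X \<subseteq> span A0" "card A0 = dim X"
    using basis_exists[of X] by metis
  obtain A where A: "A0 \<subseteq> A" "A \<subseteq> M" "independent A" "M \<subseteq> span A"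
    using maximal_independent_subset_extend[of A0 M] A0 \<open>X \<subseteq> M\<close> by blast
  have finA: "finite A" using A(3) by (rule independent_imp_finite)
  have cardA: "card A = dim M"
    using A basis_card_eq_dim[of A M] by simp
  have "A \<noteq> A0" using cardA A0(4) assms(3) by auto
  then obtain a where a: "a \<in> A" "a \<notin> A0" using A(1) by auto
  define f where "f v = representation A v a" for v
  have f_diff: "f (x - y) = f x - f y" and f_scale: "f (r *\<^sub>R x) = r * f x"
    if "x \<in> M" "y \<in> M" for x y r
    using that A(3,4) subsetD[OF A(4)]
    by (simp_all add: f_def real_vector.representation_diff real_vector.representation_scale)
  define U where "U = span (A - {a})"
  have f_expand: "v = f v *\<^sub>R a + (\<Sum>w\<in>A - {a}. representation A v w *\<^sub>R w)" if "v \<in> M" for v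
  proof -
    have "v = (\<Sum>w\<in>A. representation A v w *\<^sub>R w)"
      using sum_representation_eq[of A v A] A(3,4) finA that by auto
    then show ?thesis
      using sum.remove[OF finA a(1), of "\<lambda>w. representation A v w *\<^sub>R w"] by (simp add: f_def)
  qed
  have f_U: "v \<in> U \<longleftrightarrow> f v = 0" if "v \<in> M" for v
  proof
    assume "f v = 0"
    then have "v = (\<Sum>w\<in>A - {a}. representation A v w *\<^sub>R w)" using f_expand[OF that] by simp
    also have "\<dots> \<in> U" unfolding U_def by (intro span_sum span_scale span_base) auto
    finally show "v \<in> U" .
  next
    assume "v \<in> U"
    then have "representation A v = representation (A - {a}) v"
      unfolding U_def by (intro representation_extend[OF A(3)]) auto
    then show "f v = 0"
      using representation_ne_zero[of "A - {a}" v a] by (auto simp: f_def)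
  qed
  define M' where "M' = M \<inter> U"
  have fa: "f a = 1" using a A(3) by (simp add: f_def representation_basis)
  define R where "R = (\<Sum>w\<in>A. norm w)"
  \<comment> \<open>Reducing the coefficients other than that of \<open>a\<close> modulo 1 keeps \<open>f\<close> and makes the norm at most \<open>R\<close>,
      so the least positive value of \<open>f\<close> on \<open>M\<close> lies in a finite set.\<close>
  define F where "F = f ` {v \<in> M. norm v \<le> R} \<inter> {0<..}"
  have finF: "finite F" unfolding F_def by (intro finite_Int disjI1 finite_imageI discrete_subgroupD(3)[OF M])
  have "norm a \<le> R" unfolding R_def using a(1) finA by (intro member_le_sum) auto
  then have "1 \<in> F" unfolding F_def using fa a A(2) by force
  have "Min F \<in> F" using finF \<open>1 \<in> F\<close> by (intro Min_in) auto
  then obtain b where b: "b \<in> M" "f b = Min F" "f b > 0" unfolding F_def by auto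
  have b_min: "f b \<le> f v" if "v \<in> M" "f v > 0" for v
  proof (cases "f v \<le> 1")
    case True
    define u where "u = v - (\<Sum>w\<in>A - {a}. of_int \<lfloor>representation A v w\<rfloor> *\<^sub>R w)"
    have sM: "(\<Sum>w\<in>A - {a}. of_int \<lfloor>representation A v w\<rfloor> *\<^sub>R w) \<in> M"
      using A(2) by (intro discrete_subgroup_sum[OF M] discrete_subgroup_scaleR_int[OF M]) auto
    have sU: "(\<Sum>w\<in>A - {a}. of_int \<lfloor>representation A v w\<rfloor> *\<^sub>R w) \<in> U"
      unfolding U_def by (intro span_sum span_scale span_base) auto
    have uM: "u \<in> M" unfolding u_def using that sM by (intro discrete_subgroupD(2)[OF M])
    have fu: "f u = f v" unfolding u_def using f_diff[OF that(1) sM] f_U[OF sM] sU by simp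
    have "u = f v *\<^sub>R a + (\<Sum>w\<in>A - {a}. frac (representation A v w) *\<^sub>R w)"
      unfolding u_def frac_def by (subst (1) f_expand[OF that(1)]) (simp add: scaleR_diff_left sum_subtractf)
    also have "norm \<dots> \<le> norm (f v *\<^sub>R a) + (\<Sum>w\<in>A - {a}. norm (frac (representation A v w) *\<^sub>R w))"
      by (intro order.trans[OF norm_triangle_ineq] add_left_mono norm_sum)
    also have "\<dots> \<le> norm a + (\<Sum>w\<in>A - {a}. norm w)"
      using True that(2)
      by (intro add_mono sum_mono) (auto simp: mult_left_le_one_le frac_ge_0 less_imp_le[OF frac_lt_1])
    also have "\<dots> = R" unfolding R_def by (rule sum.remove[OF finA a(1), symmetric])
    finally have "u \<in> {v \<in> M. norm v \<le> R}" using uM by simp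
    then have "f u \<in> f ` {v \<in> M. norm v \<le> R}" by (rule imageI)
    then have "f u \<in> F" unfolding F_def using fu that(2) by simp
    then show ?thesis using fu b(2) finF by simp
  next
    case False
    \<comment> \<open>The element \<open>a\<close> has coordinate 1, so the minimum is at most
      1.\<close>
    then show ?thesis using \<open>1 \<in> F\<close> finF b(2) Min_le[of F 1] by linarith
  qed
  have dimM': "dim M' = card (A - {a})"
  proof (rule dim_unique)
    show "A - {a} \<subseteq> M'" unfolding M'_def U_def using A(2) by (auto intro: span_base)
    show "M' \<subseteq> span (A - {a})" unfolding M'_def U_def by auto
    show "independent (A - {a})" using A(3) by (rule independent_mono) auto
  qed simp
  show thesis
  proof (rule that[of M' b])
    show "discrete_subgroup M'"
      unfolding M'_def U_def by (intro discrete_subgroup_Int_subspace M subspace_span)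
    show "X \<subseteq> M'"
    proof -
      have "span A0 \<subseteq> U" unfolding U_def using A(1) a(2) by (intro span_mono) auto
      then show ?thesis unfolding M'_def using A0(3) \<open>X \<subseteq> M\<close> by auto
    qed
    show "M' \<subseteq> M" unfolding M'_def by auto
    show "b \<in> M" by fact
    show "dim M = Suc (dim M')"
      unfolding dimM' cardA[symmetric] using card.remove[OF finA a(1)] by simp
    show "\<exists>k::int. v - of_int k *\<^sub>R b \<in> M'" if v: "v \<in> M" for v
    proof
      \<comment> \<open>The remainder has its \<open>f\<close>-value in the half-open interval from
        0 to \<open>f b\<close>, so minimality of \<open>f b\<close> forces it to be 0.\<close>
      let ?k = "\<lfloor>f v / f b\<rfloor>"
      have kb: "of_int ?k *\<^sub>R b \<in> M" using discrete_subgroup_scaleR_int[OF M b(1)] .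
      have vM: "v - of_int ?k *\<^sub>R b \<in> M" using discrete_subgroupD(2)[OF M v kb] .
      have fv: "f (v - of_int ?k *\<^sub>R b) = f v - of_int ?k * f b"
        using f_diff[OF v kb] f_scale[OF b(1) b(1)] by simp
      have "of_int ?k * f b \<le> f v" "f v < (of_int ?k + 1) * f b"
        using floor_divide_lower[OF b(3)] floor_divide_upper[OF b(3)] by blast+
      then have "f (v - of_int ?k *\<^sub>R b) \<ge> 0" "f (v - of_int ?k *\<^sub>R b) < f b"
        unfolding fv by (simp_all add: algebra_simps)
      then have "f (v - of_int ?k *\<^sub>R b) = 0" using b_min[OF vM] by linarith
      then show "v - of_int ?k *\<^sub>R b \<in> M'" unfolding M'_def using f_U[OF vM] vM by auto
    qed
    show "of_int k *\<^sub>R b \<notin> M'" if "k \<noteq> 0" for k :: int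
    proof -
      have kb: "of_int k *\<^sub>R b \<in> M" using discrete_subgroup_scaleR_int[OF M b(1)] .
      have "f (of_int k *\<^sub>R b) = of_int k * f b" using f_scale[OF b(1) b(1)] by simp
      then have "f (of_int k *\<^sub>R b) \<noteq> 0" using b(3) that by simp
      then show ?thesis unfolding M'_def using f_U[OF kb] by auto
    qed
  qed
qed

section \<open>Ball families that are disjoint modulo a multiple of the group\<close>

text \<open>Strictly more than 2 means that closed unit balls around different centres stay disjoint
  under all translations by \<open>p\<close> times \<open>M\<close>. A ball may still meet its own
  translates: \<open>c = c'\<close> is exempt.\<close>

definition separated_mod :: "nat \<Rightarrow> 'a::euclidean_space set \<Rightarrow> 'a set \<Rightarrow> bool" where
  "separated_mod p M C \<longleftrightarrow>
     (\<forall>c\<in>C. \<forall>c'\<in>C. c \<noteq> c' \<longrightarrow> (\<forall>v\<in>M. norm (c - c' - real p *\<^sub>R v) > 2))"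

text \<open>Keeping the centre along with the point allows each ball to be moved by its own vector,
  as a map on pairs.\<close>

definition incidences :: "'a::euclidean_space set \<Rightarrow> 'a set \<Rightarrow> ('a \<times> 'a) set" where
  "incidences M C = {(c, x). c \<in> C \<and> x \<in> M \<and> norm (x - c) \<le> 1}"

text \<open>This moves \<open>c\<close> into the Voronoi cell of 0 for \<open>p\<close> times
  \<open>M\<close>. Only finitely many translates are no longer than \<open>c\<close>, so a shortest
  one exists.\<close>

lemma minimal_coset_representative:
  assumes M: "discrete_subgroup M" and "p > 0"
  obtains s where "s \<in> M"
    "\<And>v. v \<in> M \<Longrightarrow> norm (c - real p *\<^sub>R s) \<le> norm (c - real p *\<^sub>R s - real p *\<^sub>R v)"
proof -
  define F where "F = {v \<in> M. norm (c - real p *\<^sub>R v) \<le> norm c}"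
  have "F \<subseteq> {v \<in> M. norm v \<le> 2 * norm c}"
  proof
    fix v assume v: "v \<in> F"
    have "norm v \<le> real p * norm v" using assms(2) by (simp add: mult_le_cancel_right1)
    also have "\<dots> = norm (c - (c - real p *\<^sub>R v))" by simp
    also have "\<dots> \<le> norm c + norm (c - real p *\<^sub>R v)" by (rule norm_triangle_ineq4)
    also have "\<dots> \<le> 2 * norm c" using v by (simp add: F_def)
    finally show "v \<in> {v \<in> M. norm v \<le> 2 * norm c}" using v by (simp add: F_def)
  qed
  then have "finite F" using discrete_subgroupD(3)[OF M] by (rule finite_subset)
  moreover have F0: "0 \<in> F" unfolding F_def using discrete_subgroupD(1)[OF M] by simp
  ultimately obtain s where s: "s \<in> F" "\<And>v. v \<in> F \<Longrightarrow> norm (c - real p *\<^sub>R s) \<le> norm (c - real p *\<^sub>R v)"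
    using arg_min_if_finite[of F "\<lambda>v. norm (c - real p *\<^sub>R v)"] by (metis empty_iff not_less)
  \<comment> \<open>Outside \<open>F\<close> the translate is longer than \<open>c\<close>, hence
    longer than the minimum, so minimality on \<open>F\<close> extends to \<open>M\<close>.\<close>
  have "norm (c - real p *\<^sub>R s) \<le> norm (c - real p *\<^sub>R v)" if "v \<in> M" for v
    using s(2)[of v] s(1) that unfolding F_def by fastforce
  moreover have "s \<in> M" using s(1) by (simp add: F_def)
  moreover have "c - real p *\<^sub>R (s + v) = c - real p *\<^sub>R s - real p *\<^sub>R v" for v
    by (simp add: algebra_simps)
  ultimately show thesis
    using that[of s] discrete_subgroup_add[OF M] by metis
qed

text \<open>
  For centres in the Voronoi cell of \<open>pM\<close>, their difference \<open>c\<close> satisfies \<open>c \<bullet> v \<le> p\<bar>v\<bar>\<^sup>2\<close>, so that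
  \<open>\<bar>c - p'v\<bar>\<^sup>2 - \<bar>c - pv\<bar>\<^sup>2 = (p' - p)((p' + p)\<bar>v\<bar>\<^sup>2 - 2 c \<bullet> v) \<ge> 0\<close>.
\<close>
lemma separated_mod_stretch:
  fixes M :: "'a::euclidean_space set"
  assumes M: "discrete_subgroup M" and "p > 0" "p \<le> p'" and C: "separated_mod p M C"
  obtains C' where "separated_mod p' M C'"
    "\<exists>\<phi>. inj_on \<phi> (incidences M C) \<and> \<phi> ` incidences M C \<subseteq> incidences M C'"
proof -
  have "\<forall>c. \<exists>s\<in>M. \<forall>v\<in>M. norm (c - real p *\<^sub>R s) \<le> norm (c - real p *\<^sub>R s - real p *\<^sub>R v)"
    using minimal_coset_representative[OF M \<open>p > 0\<close>] by metis
  then obtain s where sM: "\<And>c. s c \<in> M"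
    and s_min: "\<And>c v. v \<in> M \<Longrightarrow> norm (c - real p *\<^sub>R s c) \<le> norm (c - real p *\<^sub>R s c - real p *\<^sub>R v)"
    by metis
  define h where "h c = c - real p *\<^sub>R s c" for c
  \<comment> \<open>The shifts lie in \<open>p\<close> times \<open>M\<close>, so they are absorbed
    in the quantifier over \<open>M\<close> and the separation survives.\<close>
  have far: "norm (h c - h c' - real p *\<^sub>R v) > 2" if "c \<in> C" "c' \<in> C" "c \<noteq> c'" "v \<in> M" for c c' v
  proof -
    have "s c - s c' + v \<in> M"
      using sM that discrete_subgroup_add[OF M] discrete_subgroupD(2)[OF M] by blast
    then have "norm (c - c' - real p *\<^sub>R (s c - s c' + v)) > 2"
      using C that unfolding separated_mod_def by blast
    then show ?thesis by (simp add: h_def algebra_simps)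
  qed
  have voronoi: "2 * (h c \<bullet> v) \<le> real p * (v \<bullet> v)" if "v \<in> M" for c v
  proof -
    have "(norm (h c))\<^sup>2 \<le> (norm (h c - real p *\<^sub>R v))\<^sup>2"
      unfolding h_def using s_min[OF that] by (intro power_mono) auto
    then have "real p * (2 * (h c \<bullet> v)) \<le> real p * (real p * (v \<bullet> v))"
      unfolding power2_norm_eq_inner by (simp add: algebra_simps inner_commute)
    then show ?thesis using \<open>p > 0\<close> by simp
  qed
  have sep: "separated_mod p' M (h ` C)"
    unfolding separated_mod_def
  proof (intro ballI impI)
    fix d d' v assume d: "d \<in> h ` C" "d' \<in> h ` C" "d \<noteq> d'" and v: "v \<in> M"
    from d obtain c c' where c: "c \<in> C" "c' \<in> C" "d = h c" "d' = h c'" "c \<noteq> c'" by auto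
    have "- v \<in> M" using discrete_subgroupD(2)[OF M discrete_subgroupD(1)[OF M] v] by simp
    \<comment> \<open>The cell inequality for \<open>h c\<close> at \<open>v\<close> and for
      \<open>h c'\<close> at \<open>- v\<close> add up to the one for the difference.\<close>
    then have *: "(h c - h c') \<bullet> v \<le> real p * (v \<bullet> v)"
      using voronoi[OF v, of c] voronoi[of "- v" c'] by (simp add: inner_diff_left)
    have diff: "(norm (h c - h c' - real p' *\<^sub>R v))\<^sup>2 - (norm (h c - h c' - real p *\<^sub>R v))\<^sup>2
       = (real p' - real p) * ((real p' + real p) * (v \<bullet> v) - 2 * ((h c - h c') \<bullet> v))"
      unfolding power2_norm_eq_inner by (simp add: algebra_simps inner_commute)
    have "0 \<le> (real p' - real p) * ((real p' + real p) * (v \<bullet> v) - 2 * ((h c - h c') \<bullet> v))"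
    proof (rule mult_nonneg_nonneg)
      have "2 * real p * (v \<bullet> v) \<le> (real p' + real p) * (v \<bullet> v)"
        using \<open>p \<le> p'\<close> by (intro mult_right_mono) auto
      then show "0 \<le> (real p' + real p) * (v \<bullet> v) - 2 * ((h c - h c') \<bullet> v)"
        using * by linarith
    qed (use \<open>p \<le> p'\<close> in simp)
    then have "(norm (h c - h c' - real p *\<^sub>R v))\<^sup>2 \<le> (norm (h c - h c' - real p' *\<^sub>R v))\<^sup>2"
      unfolding diff[symmetric] by simp
    then have "norm (h c - h c' - real p *\<^sub>R v) \<le> norm (h c - h c' - real p' *\<^sub>R v)"
      by (rule power2_le_imp_le) simp
    then show "norm (d - d' - real p' *\<^sub>R v) > 2"
      using far[OF c(1,2,5) v] c(3,4) by simp
  qed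
  \<comment> \<open>A ball and its points move by the same vector of \<open>M\<close>, which keeps
    the points in \<open>M\<close>.\<close>
  define \<phi> where "\<phi> = (\<lambda>(c, x). (h c, x - real p *\<^sub>R s c))"
  have h_inj: "inj_on h C"
  proof (rule inj_onI, rule ccontr)
    fix c c' assume "c \<in> C" "c' \<in> C" "h c = h c'" "c \<noteq> c'"
    then show False using far[OF _ _ _ discrete_subgroupD(1)[OF M], of c c'] by simp
  qed
  have "inj_on \<phi> (incidences M C)"
    using h_inj by (auto simp: inj_on_def \<phi>_def incidences_def)
  moreover have "\<phi> ` incidences M C \<subseteq> incidences M (h ` C)"
    unfolding incidences_def \<phi>_def
    using discrete_subgroupD(2)[OF M] discrete_subgroup_scaleR_nat[OF M sM]
    by (auto simp: h_def)
  ultimately show thesis using that[OF sep] by blast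
qed

text \<open>Each of the \<open>q\<close> residue classes of layers is carried injectively into the
  incidences of \<open>M'\<close> with a family separated modulo \<open>q\<close>, so it contributes
  at most \<open>N\<close>.\<close>

lemma separated_mod_slice:
  fixes M :: "'a::euclidean_space set"
  assumes M: "discrete_subgroup M" and M': "discrete_subgroup M'" "M' \<subseteq> M" and b: "b \<in> M"
    and b_gen: "\<And>v. v \<in> M \<Longrightarrow> \<exists>k::int. v - of_int k *\<^sub>R b \<in> M'"
    and b_indep: "\<And>k::int. k \<noteq> 0 \<Longrightarrow> of_int k *\<^sub>R b \<notin> M'"
    and short: "\<And>v. v \<in> M \<Longrightarrow> real q * norm v \<le> 2 \<Longrightarrow> v \<in> M'"
    and "q > 0" and C: "separated_mod q M C"
    and bound: "\<And>C'. separated_mod q M' C' \<Longrightarrow> finite (incidences M' C') \<and> card (incidences M' C') \<le> N"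
  shows "finite (incidences M C) \<and> card (incidences M C) \<le> q * N"
proof -
  obtain k :: "'a \<Rightarrow> int" where k: "\<And>v. v \<in> M \<Longrightarrow> v - of_int (k v) *\<^sub>R b \<in> M'"
    using b_gen by metis
  define P where "P a = {(c, x) \<in> incidences M C. k x mod int q = a}" for a
  \<comment> \<open>One ball may meet several layers of the same class; each such layer contributes
    its own translate of the ball, hence the range over all \<open>l\<close>.\<close>
  define D where "D a = {c - of_int (a + int q * l) *\<^sub>R b | c l. c \<in> C}" for a
  have D_sep: "separated_mod q M' (D a)" for a
    unfolding separated_mod_def
  proof (intro ballI impI)
    fix d d' v assume d: "d \<in> D a" "d' \<in> D a" "d \<noteq> d'" and v: "v \<in> M'"
    from d obtain c l c' l' where c: "c \<in> C" "c' \<in> C"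
      "d = c - of_int (a + int q * l) *\<^sub>R b" "d' = c' - of_int (a + int q * l') *\<^sub>R b"
      unfolding D_def by blast
    define w where "w = of_int (l - l') *\<^sub>R b + v"
    have wM: "w \<in> M" unfolding w_def
      using v M'(2) by (intro discrete_subgroup_add[OF M] discrete_subgroup_scaleR_int[OF M b]) auto
    have eq: "d - d' - real q *\<^sub>R v = c - c' - real q *\<^sub>R w"
      unfolding c w_def by (simp add: algebra_simps)
    show "norm (d - d' - real q *\<^sub>R v) > 2"
    proof (cases "c = c'")
      case False
      then show ?thesis unfolding eq using C c(1,2) wM unfolding separated_mod_def by blast
    next
      case True
      with d(3) c have "l - l' \<noteq> 0" by auto
      \<comment> \<open>Two translates of the same ball: here separation of \<open>C\<close> says
        nothing, and \<open>short\<close> takes over because \<open>w\<close> lies outside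
        \<open>M'\<close>.\<close>
      have "w \<notin> M'"
      proof
        assume "w \<in> M'"
        then have "w - v \<in> M'" using v by (rule discrete_subgroupD(2)[OF M'(1)])
        then show False using b_indep[OF \<open>l - l' \<noteq> 0\<close>] by (simp add: w_def)
      qed
      then have "real q * norm w > 2" using short[OF wM] by force
      then show ?thesis unfolding eq using True by simp
    qed
  qed
  define \<phi> where "\<phi> = (\<lambda>(c, x). (c - of_int (k x) *\<^sub>R b, x - of_int (k x) *\<^sub>R b))"
  have img: "\<phi> ` P a \<subseteq> incidences M' (D a)" for a
  proof
    fix y assume "y \<in> \<phi> ` P a"
    then obtain c x where cx: "c \<in> C" "x \<in> M" "norm (x - c) \<le> 1" "k x mod int q = a" "y = \<phi> (c, x)"
      by (auto simp: P_def incidences_def)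
    have "k x = a + int q * (k x div int q)" using cx(4) by auto
    then have "c - of_int (k x) *\<^sub>R b = c - of_int (a + int q * (k x div int q)) *\<^sub>R b" by simp
    then have "c - of_int (k x) *\<^sub>R b \<in> D a" unfolding D_def using cx(1) by blast
    then show "y \<in> incidences M' (D a)"
      using cx k[OF cx(2)] by (simp add: \<phi>_def incidences_def)
  qed
  have inj: "inj_on \<phi> (P a)" for a
  proof (rule inj_onI)
    fix y y' assume y: "y \<in> P a" "y' \<in> P a" and eq: "\<phi> y = \<phi> y'"
    obtain c x c' x' where yy: "y = (c, x)" "y' = (c', x')" by (metis surj_pair)
    from y have c: "c \<in> C" "c' \<in> C" and "k x mod int q = k x' mod int q"
      by (auto simp: yy P_def incidences_def)
    then obtain l where l: "k x - k x' = int q * l" by (metis mod_eq_dvd_iff dvdE)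
    have e1: "c - c' = of_int (k x - k x') *\<^sub>R b" and e2: "x - x' = of_int (k x - k x') *\<^sub>R b"
      using eq by (auto simp: \<phi>_def yy algebra_simps)
    \<comment> \<open>Within one class the layer indices differ by a multiple of \<open>q\<close>,
      so equal images would put distinct centres at a difference in \<open>q\<close> times
      \<open>M\<close>.\<close>
    have "c = c'"
    proof (rule ccontr)
      assume "c \<noteq> c'"
      then have "norm (c - c' - real q *\<^sub>R (of_int l *\<^sub>R b)) > 2"
        using C c discrete_subgroup_scaleR_int[OF M b] unfolding separated_mod_def by blast
      then show False using e1 l by simp
    qed
    then have "of_int (k x - k x') *\<^sub>R b \<in> M'" unfolding e1[symmetric] using discrete_subgroupD(1)[OF M'(1)] by simp
    then have "k x - k x' = 0" using b_indep by blast
    then show "y = y'" using \<open>c = c'\<close> e2 yy by simp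
  qed
  have P: "finite (P a)" "card (P a) \<le> N" for a
  proof -
    from bound[OF D_sep[of a]] have B: "finite (incidences M' (D a))" "card (incidences M' (D a)) \<le> N"
      by auto
    show "finite (P a)" using inj_on_finite[OF inj img B(1)] .
    show "card (P a) \<le> N" using card_inj_on_le[OF inj img B(1)] B(2) by linarith
  qed
  have U: "incidences M C = (\<Union>a\<in>{0..<int q}. P a)"
    using \<open>q > 0\<close> by (auto simp: P_def)
  have "card (incidences M C) \<le> (\<Sum>a\<in>{0..<int q}. card (P a))"
    unfolding U by (intro card_UN_le) auto
  also have "\<dots> \<le> (\<Sum>a\<in>{0..<int q}. N)" by (intro sum_mono P)
  finally show ?thesis unfolding U using P(1) by auto
qed

text \<open>The modulus \<open>p\<close> is kept free below all \<open>q i\<close>: slicing leaves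
  the modulus \<open>q (Suc n)\<close> on \<open>M'\<close>, and the induction hypothesis must
  accept it although it may be smaller than \<open>q n\<close>.\<close>

lemma card_incidences_le:
  fixes M :: "'a::euclidean_space set"
  assumes "discrete_subgroup M" "dim M = n" "p > 0"
    and "\<And>i. i \<in> {1..n} \<Longrightarrow> p \<le> q i"
    and "\<And>i j. 1 \<le> i \<Longrightarrow> i \<le> j \<Longrightarrow> j \<le> n \<Longrightarrow> q j \<le> q i"
    and "\<And>i. i \<in> {1..n} \<Longrightarrow> dim {v \<in> M. real (q i) * norm v \<le> 2} < i"
    and "separated_mod p M C"
  shows "finite (incidences M C) \<and> card (incidences M C) \<le> (\<Prod>i = 1..n. q i)"
  using assms
proof (induction n arbitrary: M p C)
  case 0
  have M: "M = {0}"
    using 0(2) discrete_subgroupD(1)[OF 0(1)] by (auto simp: dim_eq_0)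
  \<comment> \<open>In rank 0 the only point is 0, and it lies in at most one of the disjoint
    balls.\<close>
  have "z = z'" if zz: "z \<in> incidences M C" "z' \<in> incidences M C" for z z'
  proof -
    obtain c c' where c: "z = (c, 0)" "z' = (c', 0)" "c \<in> C" "c' \<in> C" "norm c \<le> 1" "norm c' \<le> 1"
      using zz by (auto simp: incidences_def M)
    have "norm (c - c') \<le> 2" using norm_triangle_ineq4[of c c'] c by linarith
    then have "c = c'" using 0(7) c unfolding separated_mod_def M by force
    then show ?thesis using c by simp
  qed
  then have "incidences M C = {} \<or> (\<exists>z. incidences M C = {z})" by blast
  then show ?case by auto
next
  case (Suc n)
  note M = Suc.prems(1)
  define r where "r = q (Suc n)"
  have "p \<le> r" unfolding r_def using Suc.prems(4) by simp
  \<comment> \<open>The dimension bound at \<open>i = Suc n\<close> says that these short vectors do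
    not span \<open>M\<close>, so they fit into \<open>M'\<close>.\<close>
  define X where "X = {v \<in> M. real r * norm v \<le> 2}"
  have "dim X < dim M" unfolding X_def r_def using Suc.prems(2) Suc.prems(6)[of "Suc n"] by simp
  moreover have "X \<subseteq> M" unfolding X_def by auto
  ultimately obtain M' b where M': "discrete_subgroup M'" "X \<subseteq> M'" "M' \<subseteq> M" "b \<in> M"
    "dim M = Suc (dim M')"
    "\<And>v. v \<in> M \<Longrightarrow> \<exists>k::int. v - of_int k *\<^sub>R b \<in> M'"
    "\<And>k::int. k \<noteq> 0 \<Longrightarrow> of_int k *\<^sub>R b \<notin> M'"
    using discrete_subgroup_hyperplane[OF M] by metis
  obtain C' \<phi> where C': "separated_mod r M C'"
    and \<phi>: "inj_on \<phi> (incidences M C)" "\<phi> ` incidences M C \<subseteq> incidences M C'"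
    using separated_mod_stretch[OF M \<open>p > 0\<close> \<open>p \<le> r\<close> Suc.prems(7)] by metis
  have "finite (incidences M C') \<and> card (incidences M C') \<le> r * (\<Prod>i = 1..n. q i)"
  proof (rule separated_mod_slice[OF M M'(1,3,4) M'(6,7) _ _ C'])
    show "v \<in> M'" if "v \<in> M" "real r * norm v \<le> 2" for v
      using that M'(2) unfolding X_def by blast
    show "r > 0" using \<open>p > 0\<close> \<open>p \<le> r\<close> by simp
    show "finite (incidences M' D) \<and> card (incidences M' D) \<le> (\<Prod>i = 1..n. q i)"
      if D: "separated_mod r M' D" for D
    proof (rule Suc.IH[OF M'(1) _ \<open>r > 0\<close> _ _ _ D])
      show "dim M' = n" using M'(5) Suc.prems(2) by simp
      show "r \<le> q i" if "i \<in> {1..n}" for i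
        unfolding r_def using that Suc.prems(5)[of i "Suc n"] by simp
      show "q j \<le> q i" if "1 \<le> i" "i \<le> j" "j \<le> n" for i j
        using that Suc.prems(5) by simp
      show "dim {v \<in> M'. real (q i) * norm v \<le> 2} < i" if "i \<in> {1..n}" for i
      proof -
        have "dim {v \<in> M'. real (q i) * norm v \<le> 2} \<le> dim {v \<in> M. real (q i) * norm v \<le> 2}"
          using M'(3) by (intro dim_subset) auto
        also have "\<dots> < i" using that by (intro Suc.prems(6)) auto
        finally show ?thesis .
      qed
    qed
  qed
  moreover have "r * (\<Prod>i = 1..n. q i) = (\<Prod>i = 1..Suc n. q i)"
    by (simp add: r_def mult.commute)
  ultimately show ?case
    using inj_on_finite[OF \<phi>] card_inj_on_le[OF \<phi>] by (metis order.trans)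
qed

section \<open>Reduction of lattices and ellipsoids to the unit ball\<close>

text \<open>Coordinates with respect to \<open>B\<close> are bounded linear functionals, so a norm
  bound leaves finitely many integer coefficient vectors.\<close>

lemma is_lattice_discrete_subgroup:
  fixes \<Lambda> :: "(real ^ 'd) set"
  assumes "is_lattice \<Lambda>"
  shows "discrete_subgroup \<Lambda>" "span \<Lambda> = UNIV"
proof -
  obtain B :: "(real ^ 'd) set" where B: "independent B" "span B = UNIV"
    and \<Lambda>: "\<Lambda> = range (\<lambda>c :: real ^ 'd \<Rightarrow> int. \<Sum>b\<in>B. of_int (c b) *\<^sub>R b)"
    using assms unfolding is_lattice_def by blast
  have finB: "finite B" using B(1) by (rule independent_imp_finite)
  have "B \<subseteq> \<Lambda>"
  proof
    fix b assume "b \<in> B"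
    then have "b = (\<Sum>b'\<in>B. of_int (if b' = b then 1 else 0) *\<^sub>R b')"
      using finB by (simp add: if_distrib if_distribR cong: if_cong)
    then show "b \<in> \<Lambda>" unfolding \<Lambda> by (rule image_eqI[where x = "\<lambda>b'. if b' = b then 1 else 0"]) simp
  qed
  then show "span \<Lambda> = UNIV" using span_mono[of B \<Lambda>] B(2) by auto
  have rep: "representation B (\<Sum>b\<in>B. of_int (c b) *\<^sub>R b) b = of_int (c b)"
    if "b \<in> B" for c :: "real ^ 'd \<Rightarrow> int" and b
    using that B finB by (simp add: representation_sum representation_scale representation_basis
        if_distrib if_distribR cong: if_cong)
  have "linear (\<lambda>x. representation B x b)" for b
    using B by (intro linearI) (simp_all add: representation_add representation_scale)
  then have "\<exists>K. \<forall>x. norm (representation B x b) \<le> norm x * K" for b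
    using linear_conv_bounded_linear bounded_linear.bounded by blast
  then obtain K where K: "\<And>b x. \<bar>representation B x b\<bar> \<le> norm x * K b"
    unfolding real_norm_def by metis
  have "finite {x \<in> \<Lambda>. norm x \<le> R}" for R
  proof (rule finite_subset)
    let ?Q = "PiE B (\<lambda>b. {- \<lceil>R * \<bar>K b\<bar>\<rceil>..\<lceil>R * \<bar>K b\<bar>\<rceil>})"
    show "finite ((\<lambda>c. \<Sum>b\<in>B. of_int (c b) *\<^sub>R b) ` ?Q)"
      using finB by (intro finite_imageI finite_PiE) auto
    show "{x \<in> \<Lambda>. norm x \<le> R} \<subseteq> (\<lambda>c. \<Sum>b\<in>B. of_int (c b) *\<^sub>R b) ` ?Q"
    proof
      fix x assume "x \<in> {x \<in> \<Lambda>. norm x \<le> R}"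
      then obtain c :: "real ^ 'd \<Rightarrow> int" where x: "x = (\<Sum>b\<in>B. of_int (c b) *\<^sub>R b)" "norm x \<le> R"
        unfolding \<Lambda> by auto
      have "c b \<in> {- \<lceil>R * \<bar>K b\<bar>\<rceil>..\<lceil>R * \<bar>K b\<bar>\<rceil>}" if "b \<in> B" for b
      proof -
        have "\<bar>of_int (c b)\<bar> \<le> norm x * K b" using K[of x b] rep[OF that, of c] x(1) by simp
        also have "\<dots> \<le> norm x * \<bar>K b\<bar>" by (intro mult_left_mono) auto
        also have "\<dots> \<le> R * \<bar>K b\<bar>" using x(2) by (intro mult_right_mono) auto
        finally show ?thesis by (auto simp: abs_le_iff) linarith+
      qed
      then have "restrict c B \<in> ?Q" by auto
      moreover have "x = (\<Sum>b\<in>B. of_int (restrict c B b) *\<^sub>R b)" using x(1) by simp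
      ultimately show "x \<in> (\<lambda>c. \<Sum>b\<in>B. of_int (c b) *\<^sub>R b) ` ?Q" by blast
    qed
  qed
  moreover have "x - y \<in> \<Lambda>" if xy: "x \<in> \<Lambda>" "y \<in> \<Lambda>" for x y
  proof -
    obtain c c' :: "real ^ 'd \<Rightarrow> int"
      where "x = (\<Sum>b\<in>B. of_int (c b) *\<^sub>R b)" "y = (\<Sum>b\<in>B. of_int (c' b) *\<^sub>R b)"
      using xy unfolding \<Lambda> by blast
    then have "x - y = (\<Sum>b\<in>B. of_int (c b - c' b) *\<^sub>R b)"
      by (simp add: scaleR_diff_left sum_subtractf)
    then show ?thesis unfolding \<Lambda> by (rule image_eqI[where x = "\<lambda>b. c b - c' b"]) simp
  qed
  moreover have "0 \<in> \<Lambda>" unfolding \<Lambda> by (rule image_eqI[where x = "\<lambda>_. 0"]) simp_all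
  ultimately show "discrete_subgroup \<Lambda>" unfolding discrete_subgroup_def by blast
qed

lemma discrete_subgroup_vimage:
  fixes L :: "'a::euclidean_space \<Rightarrow> 'b::euclidean_space"
  assumes L: "linear L" "bij L" and M: "discrete_subgroup M" "span M = UNIV"
  shows "discrete_subgroup (L -` M)" "span (L -` M) = UNIV"
proof -
  have inj: "inj L" using L(2) by (rule bij_is_inj)
  obtain K where K: "\<And>x. norm (L x) \<le> norm x * K"
    using L(1) linear_conv_bounded_linear bounded_linear.bounded by blast
  have "finite {x \<in> L -` M. norm x \<le> R}" for R
  proof (rule finite_subset)
    show "finite (L -` {y \<in> M. norm y \<le> R * \<bar>K\<bar>})"
      by (intro finite_vimageI discrete_subgroupD(3)[OF M(1)] inj)
    show "{x \<in> L -` M. norm x \<le> R} \<subseteq> L -` {y \<in> M. norm y \<le> R * \<bar>K\<bar>}"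
    proof
      fix x assume x: "x \<in> {x \<in> L -` M. norm x \<le> R}"
      then have "norm x \<le> R" by simp
      have "norm (L x) \<le> norm x * \<bar>K\<bar>" using K[of x] by (rule order.trans) (intro mult_left_mono, auto)
      also have "\<dots> \<le> R * \<bar>K\<bar>" using \<open>norm x \<le> R\<close> by (intro mult_right_mono) auto
      finally show "x \<in> L -` {y \<in> M. norm y \<le> R * \<bar>K\<bar>}" using x by simp
    qed
  qed
  then show "discrete_subgroup (L -` M)"
    unfolding discrete_subgroup_def
    using discrete_subgroupD[OF M(1)] by (auto simp: linear_0[OF L(1)] linear_diff[OF L(1)])
  have "L ` (L -` M) = M" using L(2) by (simp add: bij_is_surj surj_image_vimage_eq)
  then have "L ` span (L -` M) = UNIV"
    using linear_span_image[OF L(1), of "L -` M"] M(2) by simp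
  then show "span (L -` M) = UNIV"
    using inj by (metis inj_image_eq_iff bij_is_surj L(2))
qed

text \<open>The translation \<open>t\<close> cancels, and \<open>x\<close> of norm at most 2 is the
  difference of \<open>x /\<^sub>R 2\<close> and its negative.\<close>

lemma difference_set_ellipsoid:
  fixes L :: "'a::euclidean_space \<Rightarrow> 'b::euclidean_space"
  assumes "linear L"
  shows "difference_set ((\<lambda>x. L x + t) ` cball 0 1) = L ` cball 0 2"
proof
  show "difference_set ((\<lambda>x. L x + t) ` cball 0 1) \<subseteq> L ` cball 0 2"
  proof
    fix z assume "z \<in> difference_set ((\<lambda>x. L x + t) ` cball 0 1)"
    then obtain x y where xy: "z = L (x - y)" "norm x \<le> 1" "norm y \<le> 1"
      by (auto simp: difference_set_def linear_diff[OF assms])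
    then have "norm (x - y) \<le> 2" using norm_triangle_ineq4[of x y] by linarith
    then show "z \<in> L ` cball 0 2" using xy(1) by auto
  qed
  show "L ` cball 0 2 \<subseteq> difference_set ((\<lambda>x. L x + t) ` cball 0 1)"
  proof
    fix z assume "z \<in> L ` cball 0 2"
    then obtain x where x: "z = L x" "norm x \<le> 2" by auto
    define u where "u = x /\<^sub>R 2"
    have "u - (- u) = x" by (simp add: u_def flip: scaleR_left_distrib)
    then have "z = (L u + t) - (L (- u) + t)"
      using linear_diff[OF assms, of u "- u"] x(1) by simp
    moreover have "u \<in> cball 0 1" "- u \<in> cball 0 1" using x(2) by (simp_all add: u_def)
    ultimately show "z \<in> difference_set ((\<lambda>x. L x + t) ` cball 0 1)"
      unfolding difference_set_def by blast
  qed
qed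

text \<open>The lattice points in the scaled body are the images under \<open>L\<close> of the
  vectors of norm at most \<open>2 * l\<close>, and the injective \<open>L\<close> preserves
  dimension.\<close>

lemma successive_min_ellipsoid:
  fixes \<Lambda> :: "(real ^ 'd) set" and L :: "real ^ 'd \<Rightarrow> real ^ 'd"
  assumes L: "linear L" "bij L"
  shows "successive_min i (L ` cball 0 2) \<Lambda> =
    Inf {l. l > 0 \<and> i \<le> dim {v \<in> L -` \<Lambda>. norm v \<le> 2 * l}}"
proof -
  have inj: "inj L" using L(2) by (rule bij_is_inj)
  have "(\<exists>S. S \<subseteq> ((\<lambda>x. l *\<^sub>R x) ` L ` cball 0 2) \<inter> \<Lambda> \<and> independent S \<and> card S = i) \<longleftrightarrow>
      i \<le> dim {v \<in> L -` \<Lambda>. norm v \<le> 2 * l}" if l: "l > 0" for l :: real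
  proof -
    let ?V = "{v \<in> L -` \<Lambda>. norm v \<le> 2 * l}"
    have image: "((\<lambda>x. l *\<^sub>R x) ` L ` cball 0 2) \<inter> \<Lambda> = L ` ?V"
    proof (intro equalityI subsetI)
      fix y assume "y \<in> ((\<lambda>x. l *\<^sub>R x) ` L ` cball 0 2) \<inter> \<Lambda>"
      then obtain x where "y = l *\<^sub>R L x" "x \<in> cball 0 2" "y \<in> \<Lambda>" by blast
      then have "y = L (l *\<^sub>R x)" "norm x \<le> 2" "y \<in> \<Lambda>" by (simp_all add: linear_scale[OF L(1)])
      then show "y \<in> L ` ?V" using l by (intro image_eqI[of _ _ "l *\<^sub>R x"]) auto
    next
      fix y assume "y \<in> L ` ?V"
      then obtain v where v: "y = L v" "y \<in> \<Lambda>" "norm v \<le> 2 * l" by auto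
      then have "y = l *\<^sub>R L ((1 / l) *\<^sub>R v)" "(1 / l) *\<^sub>R v \<in> cball 0 2"
        using l by (auto simp: linear_scale[OF L(1)] field_simps)
      then show "y \<in> ((\<lambda>x. l *\<^sub>R x) ` L ` cball 0 2) \<inter> \<Lambda>" using v(2) by blast
    qed
    have "dim (L ` ?V) = dim ?V" by (rule dim_image_eq[OF L(1) inj_on_subset[OF inj subset_UNIV]])
    moreover have "(\<exists>S. S \<subseteq> L ` ?V \<and> independent S \<and> card S = i) \<longleftrightarrow> i \<le> dim (L ` ?V)"
    proof
      assume "\<exists>S. S \<subseteq> L ` ?V \<and> independent S \<and> card S = i"
      then obtain S where "S \<subseteq> L ` ?V" "independent S" "card S = i" by blast
      then show "i \<le> dim (L ` ?V)" using independent_card_le_dim[of S "L ` ?V"] by simp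
    next
      assume i: "i \<le> dim (L ` ?V)"
      obtain T where T: "T \<subseteq> L ` ?V" "independent T" "card T = dim (L ` ?V)"
        by (rule basis_exists[of "L ` ?V"])
      obtain S where S: "S \<subseteq> T" "card S = i"
        using obtain_subset_with_card_n[of i T] i T(3) by metis
      then have "independent S" using T(2) independent_mono by blast
      then show "\<exists>S. S \<subseteq> L ` ?V \<and> independent S \<and> card S = i"
        using S T(1) by (intro exI[of _ S]) simp
    qed
    ultimately show ?thesis unfolding image by simp
  qed
  then show ?thesis unfolding successive_min_def by (simp only: cong: conj_cong)
qed

text \<open>Finiteness is asserted separately because \<open>card\<close> is 0 on infinite sets. The
  bound is the incidence bound for a single ball.\<close>

theorem theorem1:
  fixes E \<Lambda> :: "(real ^ 'd) set"
  assumes "is_ellipsoid E"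
    and "is_lattice \<Lambda>"
  shows "finite (E \<inter> \<Lambda>) \<and>
    int (card (E \<inter> \<Lambda>)) \<le>
      (\<Prod>i = 1..CARD('d). \<lfloor>1 / successive_min i (difference_set E) \<Lambda> + 1\<rfloor>)"
proof -
  obtain L :: "real ^ 'd \<Rightarrow> real ^ 'd" and t :: "real ^ 'd" where L: "linear L" "bij L" and E: "E = (\<lambda>x. L x + t) ` cball 0 1"
    using assms(1) unfolding is_ellipsoid_def by blast
  define M where "M = L -` \<Lambda>"
  have M: "discrete_subgroup M" "span M = UNIV"
    using discrete_subgroup_vimage[OF L is_lattice_discrete_subgroup[OF assms(2)]] by (auto simp: M_def)
  have dimM: "dim M = CARD('d)"
    by (metis M(2) dim_UNIV dim_span DIM_cart DIM_real mult.right_neutral)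
  define A where "A i = {l. l > 0 \<and> i \<le> dim {v \<in> M. norm v \<le> 2 * l}}" for i
  define m where "m i = successive_min i (difference_set E) \<Lambda>" for i
  have m: "m i = Inf (A i)" for i
    unfolding m_def E difference_set_ellipsoid[OF L(1)] successive_min_ellipsoid[OF L] A_def M_def ..
  have bdd: "bdd_below (A i)" for i unfolding A_def by (rule bdd_belowI[of _ 0]) auto
  \<comment> \<open>A large ball contains a basis of \<open>M\<close>; without this
    \<open>Inf\<close> would have no meaning.\<close>
  have ne: "A i \<noteq> {}" if "i \<le> CARD('d)" for i
  proof -
    obtain B where B: "B \<subseteq> M" "independent B" "card B = dim M" using basis_exists[of M] by metis
    have "finite B" using B(2) by (rule independent_imp_finite)
    define l where "l = (\<Sum>b\<in>B. norm b) + 1"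
    have "l > 0" unfolding l_def by (smt (verit) norm_ge_zero sum_nonneg)
    have "norm b \<le> 2 * l" if "b \<in> B" for b
      using member_le_sum[of b B norm] that \<open>finite B\<close> \<open>l > 0\<close> by (simp add: l_def)
    then have "B \<subseteq> {v \<in> M. norm v \<le> 2 * l}" using B(1) by auto
    then have "dim M \<le> dim {v \<in> M. norm v \<le> 2 * l}" using B independent_card_le_dim by metis
    then have "l \<in> A i" unfolding A_def using that dimM \<open>l > 0\<close> by simp
    then show ?thesis by auto
  qed
  \<comment> \<open>Nonzero vectors of \<open>M\<close> have norm at least \<open>Min F\<close>,
    where the inserted 1 covers those longer than 1. Dividing by 3 rather than 2 makes the
    inequality strict.\<close>
  obtain e where e: "e > 0" "\<And>v. v \<in> M \<Longrightarrow> v \<noteq> 0 \<Longrightarrow> norm v > 2 * e"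
  proof -
    define F where "F = insert 1 (norm ` ({v \<in> M. norm v \<le> 1} - {0}))"
    have F: "finite F" "F \<noteq> {}" unfolding F_def using discrete_subgroupD(3)[OF M(1)] by auto
    then have "Min F > 0" by (subst Min_gr_iff) (auto simp: F_def)
    moreover have "norm v \<ge> Min F" if "v \<in> M" "v \<noteq> 0" for v
    proof (cases "norm v \<le> 1")
      case True
      then show ?thesis using that F by (intro Min_le) (auto simp: F_def)
    next
      case False
      then show ?thesis using Min_le[OF F(1), of 1] by (simp add: F_def)
    qed
    ultimately show thesis using that[of "Min F / 3"] by force
  qed
  have m_pos: "m i > 0" if "1 \<le> i" "i \<le> CARD('d)" for i
  proof -
    have "e \<le> l" if "l \<in> A i" for l
    proof (rule ccontr)
      assume "\<not> e \<le> l"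
      then have "{v \<in> M. norm v \<le> 2 * l} \<subseteq> {0}" using e(2) by force
      then have "dim {v \<in> M. norm v \<le> 2 * l} = 0" unfolding dim_eq_0 .
      moreover have "i \<le> dim {v \<in> M. norm v \<le> 2 * l}" using \<open>l \<in> A i\<close> by (simp add: A_def)
      ultimately show False using \<open>1 \<le> i\<close> by linarith
    qed
    then have "e \<le> m i" unfolding m using ne[OF that(2)] by (intro cInf_greatest)
    then show ?thesis using e(1) by simp
  qed
  have m_mono: "m i \<le> m j" if "i \<le> j" "j \<le> CARD('d)" for i j
    unfolding m using that by (intro cInf_superset_mono ne bdd) (auto simp: A_def)
  define q where "q i = nat \<lfloor>1 / m i + 1\<rfloor>" for i
  have q: "int (q i) = \<lfloor>1 / m i + 1\<rfloor>" "q i \<ge> 1" if "1 \<le> i" "i \<le> CARD('d)" for i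
  proof -
    have "\<lfloor>1 / m i + 1\<rfloor> \<ge> 1" using m_pos[OF that] by (simp add: le_floor_iff)
    then show "int (q i) = \<lfloor>1 / m i + 1\<rfloor>" "q i \<ge> 1" unfolding q_def by linarith+
  qed
  \<comment> \<open>The centre of the ellipsoid in the new coordinates.\<close>
  define c where "c = inv L t"
  have Lc: "L c = t" unfolding c_def using L(2) by (simp add: bij_is_surj surj_f_inv_f)
  have "finite (incidences M {c}) \<and> card (incidences M {c}) \<le> (\<Prod>i = 1..CARD('d). q i)"
  proof (rule card_incidences_le[OF M(1) dimM, of 1])
    show "1 \<le> q i" if "i \<in> {1..CARD('d)}" for i using that q(2) by simp
    show "q j \<le> q i" if "1 \<le> i" "i \<le> j" "j \<le> CARD('d)" for i j
    proof -
      have "1 / m j \<le> 1 / m i" using m_mono[of i j] m_pos[of i] that by (intro divide_left_mono) auto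
      then show ?thesis unfolding q_def by (intro nat_mono floor_mono) simp
    qed
    \<comment> \<open>Otherwise \<open>1 / q i\<close> lies in \<open>A i\<close>, so
      \<open>q i\<close> is at most \<open>1 / m i\<close>; but the floor of
      \<open>1 / m i + 1\<close> exceeds \<open>1 / m i\<close>.\<close>
    show "dim {v \<in> M. real (q i) * norm v \<le> 2} < i" if "i \<in> {1..CARD('d)}" for i
    proof (rule ccontr)
      assume "\<not> dim {v \<in> M. real (q i) * norm v \<le> 2} < i"
      moreover have qi: "real (q i) > 0" using q(2)[of i] that by simp
      ultimately have "1 / real (q i) \<in> A i"
        by (simp add: A_def field_simps)
      then have "m i \<le> 1 / real (q i)" unfolding m by (intro cInf_lower bdd)
      then have "real (q i) \<le> 1 / m i" using qi m_pos[of i] that by (simp add: field_simps)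
      moreover have "real (q i) > 1 / m i"
        using q(1)[of i] that by (metis atLeastAtMost_iff of_int_of_nat_eq floor_add_int floor_correct
            floor_one of_int_add of_int_1 add_less_cancel_right)
      ultimately show False by simp
    qed
    \<comment> \<open>With one centre the condition is vacuous, so the induction can start from
      modulus 1.\<close>
    show "separated_mod 1 M {c}" by (simp add: separated_mod_def)
  qed simp
  moreover have "E \<inter> \<Lambda> = (\<lambda>z. L (snd z)) ` incidences M {c}"
  proof (intro equalityI subsetI)
    fix y assume "y \<in> E \<inter> \<Lambda>"
    then obtain u where u: "y = L (u + c)" "norm u \<le> 1" "y \<in> \<Lambda>"
      by (auto simp: E linear_add[OF L(1)] Lc)
    then have "(c, u + c) \<in> incidences M {c}" by (simp add: incidences_def M_def)
    then show "y \<in> (\<lambda>z. L (snd z)) ` incidences M {c}" using u(1) by force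
  next
    fix y assume "y \<in> (\<lambda>z. L (snd z)) ` incidences M {c}"
    then obtain x where x: "y = L x" "y \<in> \<Lambda>" "norm (x - c) \<le> 1"
      by (auto simp: incidences_def M_def)
    then have "y = L (x - c) + t" by (simp add: linear_diff[OF L(1)] Lc)
    then show "y \<in> E \<inter> \<Lambda>" using x(2,3) by (simp add: E)
  qed
  ultimately have "finite (E \<inter> \<Lambda>)" "card (E \<inter> \<Lambda>) \<le> (\<Prod>i = 1..CARD('d). q i)"
    using card_image_le order.trans by (auto, blast)
  moreover have "int (\<Prod>i = 1..CARD('d). q i) = (\<Prod>i = 1..CARD('d). \<lfloor>1 / m i + 1\<rfloor>)"
    unfolding of_nat_prod using q(1) by (intro prod.cong) auto
  ultimately show ?thesis
    unfolding m_def[symmetric] by (metis of_nat_le_iff)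
qed

end
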